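(* $\lim_{s \to \infty} \overline{\alpha_s} = \overline{\alpha}$.
   Context: A three-term geometric progression is a triple $(a, ak, ak^2)$ of positive integers with $k\in\mathbb{Q}$, $k>1$; its ratio involves only the primes at most $s$ if $k=u/v$ with $u,v$ positive integers all of whose prime factors are $\le s$. $g_s(N)$ is the cardinality of the largest subset of $\{1,\dots,N\}$ with no three-term geometric progression whose ratio involves only primes at most $s$, and $\overline{\alpha_s}=\lim_{N\to\infty}g_s(N)/N$ (this limit exists). $\overline{\alpha}=\sup\{\bar d(A): A\subset\mathbb{N}\text{ contains no three-term geometric progression}\}$, where $\bar d$ denotes upper density. *)

theory Defs
  imports "HOL-Analysis.Analysis" "HOL-Computational_Algebra.Primes"
begin

definition geom_prog3 :: "rat \<Rightarrow> nat \<Rightarrow> nat \<Rightarrow> nat \<Rightarrow> bool" where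
  "geom_prog3 k a b c \<longleftrightarrow>
     0 < a \<and> 0 < b \<and> 0 < c \<and> 1 < k \<and>
     of_nat b = of_nat a * k \<and> of_nat c = of_nat a * k ^ 2"

definition ratio_primes_le :: "nat \<Rightarrow> rat \<Rightarrow> bool" where
  "ratio_primes_le s k \<longleftrightarrow>
     (\<exists>u v :: nat. 0 < u \<and> 0 < v \<and> k = of_nat u / of_nat v \<and>
        (\<forall>p\<in>prime_factors u. p \<le> s) \<and> (\<forall>p\<in>prime_factors v. p \<le> s))"

definition gp_free :: "nat set \<Rightarrow> bool" where
  "gp_free A \<longleftrightarrow>
     \<not> (\<exists>k. \<exists>a\<in>A. \<exists>b\<in>A. \<exists>c\<in>A. geom_prog3 k a b c)"

definition smooth_gp_free :: "nat \<Rightarrow> nat set \<Rightarrow> bool" where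
  "smooth_gp_free s A \<longleftrightarrow>
     \<not> (\<exists>k. ratio_primes_le s k \<and> (\<exists>a\<in>A. \<exists>b\<in>A. \<exists>c\<in>A. geom_prog3 k a b c))"

definition g_max :: "nat \<Rightarrow> nat \<Rightarrow> nat" where
  "g_max s N = Max {card A | A. A \<subseteq> {1..N} \<and> smooth_gp_free s A}"

definition alpha_bar_smooth :: "nat \<Rightarrow> real" where
  "alpha_bar_smooth s = lim (\<lambda>N. real (g_max s N) / real N)"

(* Extended reals, because limsup and Sup are total there; all values lie in [0, 1]. *)
definition upper_density :: "nat set \<Rightarrow> ereal" where
  "upper_density A = limsup (\<lambda>N. ereal (real (card (A \<inter> {1..N})) / real N))"

definition alpha_bar :: ereal where
  "alpha_bar = Sup {upper_density A | A. A \<subseteq> {1..} \<and> gp_free A}"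

end

theory Submission
  imports Defs
begin

text \<open>
  A progression is \<open>(m v\<^sup>2, m u v, m u\<^sup>2)\<close>, so if no element has a divisor \<open>u\<^sup>2\<close> with \<open>u > s\<close>, then all
  ratios involve only primes at most \<open>s\<close>. Discarding the elements with such a divisor costs density
  at most \<open>1 / s\<close>. Hence the unrestricted supremum lies between the \<open>s\<close>-smooth one minus \<open>1 / s\<close> and
  the \<open>s\<close>-smooth one.

  The limit defining the \<open>s\<close>-smooth density exists because a smooth ratio preserves the part of a
  number that is coprime to \<open>s!\<close>. The problem on \<open>{1..N}\<close> splits into independent copies, one for each
  rough \<open>m \<le> N\<close>, of the problem on the smooth numbers up to \<open>N / m\<close>. Grouping by the places where the
  optimum on smooth numbers jumps gives a sum over smooth numbers that is dominated by \<open>\<Sum> 1 / n\<close>.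
\<close>

section \<open>Three-term progressions\<close>

text \<open>Write \<open>b / a\<close> as \<open>u / v\<close> in lowest terms, with
  \<open>g = gcd a b\<close>. Then \<open>a * c = b ^ 2\<close> becomes
  \<open>v * c = g * u^2\<close>, and \<open>v\<close>, being coprime to \<open>u^2\<close>, divides
  \<open>g\<close>; the quotient is \<open>m\<close>.\<close>

lemma geom_prog3_normal_form:
  assumes "geom_prog3 k a b c"
  obtains m u v where "0 < m" "0 < v" "v < u" "k = of_nat u / of_nat v"
    "a = m * v^2" "b = m * u * v" "c = m * u^2"
proof -
  have pos: "0 < a" "0 < b" "0 < c" "1 < k" and b: "of_nat b = of_nat a * k"
    and c: "of_nat c = of_nat a * k ^ 2"
    using assms by (auto simp: geom_prog3_def)
  have "of_nat a * of_nat c = (of_nat b :: rat) ^ 2"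
    by (simp add: b c power2_eq_square)
  hence ac: "a * c = b ^ 2" by (metis of_nat_eq_iff of_nat_mult of_nat_power)
  have "(of_nat a :: rat) < of_nat b"
    using pos by (simp add: b)
  hence ab: "a < b" by simp
  define g u v where "g = gcd a b" and "u = b div g" and "v = a div g"
  have g: "0 < g" using pos by (simp add: g_def)
  have a': "a = g * v" and b': "b = g * u" by (simp_all add: g_def u_def v_def)
  have cop: "coprime u v"
    unfolding u_def v_def g_def using pos by (metis coprime_commute div_gcd_coprime neq0_conv)
  have v: "0 < v" "v < u" using ab pos by (auto simp: a' b')
  have "v * c = g * u^2"
    using ac g by (simp add: a' b' power2_eq_square)
  moreover have "coprime v (u^2)" using cop by (simp add: coprime_commute)
  ultimately have "v dvd g"
    by (metis coprime_dvd_mult_left_iff dvd_triv_left)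
  then obtain m where m: "g = v * m" by blast
  show ?thesis
  proof
    show "0 < m" using g m by simp
    show "k = of_nat u / of_nat v"
      using b v g by (simp add: a' b' field_simps)
    show "a = m * v^2" "b = m * u * v" by (simp_all add: a' b' m power2_eq_square)
    show "c = m * u^2"
      using \<open>v * c = g * u^2\<close> v by (simp add: m)
  qed (use v in auto)
qed

lemma geom_prog3_scale:
  "0 < m \<Longrightarrow> geom_prog3 k (m * a) (m * b) (m * c) \<longleftrightarrow> geom_prog3 k a b c"
  by (auto simp: geom_prog3_def)

lemma smooth_gp_free_scale:
  assumes "0 < m"
  shows "smooth_gp_free s ((*) m ` A) \<longleftrightarrow> smooth_gp_free s A"
  using assms by (simp add: smooth_gp_free_def geom_prog3_scale)

lemma smooth_gp_free_mono: "smooth_gp_free s B \<Longrightarrow> A \<subseteq> B \<Longrightarrow> smooth_gp_free s A"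
  unfolding smooth_gp_free_def by blast

lemma smooth_gp_free_empty [simp]: "smooth_gp_free s {}"
  by (simp add: smooth_gp_free_def)

section \<open>Extremal size of progression-free subsets\<close>

text \<open>The maximum behind \<open>g_max\<close>, over an arbitrary ground set, so that it also
  applies to the pieces into which an interval is split.\<close>

definition max_free :: "nat \<Rightarrow> nat set \<Rightarrow> nat" where
  "max_free s X = Max {card A | A. A \<subseteq> X \<and> smooth_gp_free s A}"

lemma g_max_eq: "g_max s N = max_free s {1..N}"
  by (simp add: g_max_def max_free_def)

lemma finite_cards: "finite X \<Longrightarrow> finite {card A | A. A \<subseteq> X \<and> smooth_gp_free s A}"
  by (rule finite_surj[of "Pow X" _ card]) auto

lemma max_free_ge:
  assumes "finite X" "A \<subseteq> X" "smooth_gp_free s A"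
  shows "card A \<le> max_free s X"
  unfolding max_free_def using assms by (intro Max_ge finite_cards) auto

lemma max_free_attained:
  assumes "finite X"
  obtains A where "A \<subseteq> X" "smooth_gp_free s A" "card A = max_free s X"
proof -
  have "max_free s X \<in> {card A | A. A \<subseteq> X \<and> smooth_gp_free s A}"
    unfolding max_free_def using assms by (intro Max_in finite_cards) auto
  thus ?thesis using that by auto
qed

lemma max_free_mono:
  assumes "finite Y" "X \<subseteq> Y"
  shows "max_free s X \<le> max_free s Y"
  by (metis assms finite_subset max_free_attained max_free_ge order.trans)

text \<open>Deleting \<open>x\<close> from an optimal set leaves a competitor for \<open>X\<close>.
  Together with monotonicity this makes every jump 0 or 1.\<close>

lemma max_free_insert_le:
  assumes "finite X"
  shows "max_free s (insert x X) \<le> max_free s X + 1"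
proof -
  obtain A where A: "A \<subseteq> insert x X" "smooth_gp_free s A" "card A = max_free s (insert x X)"
    using assms by (metis finite_insert max_free_attained)
  have "card (A - {x}) \<le> max_free s X"
    using A assms by (intro max_free_ge smooth_gp_free_mono[OF A(2)]) auto
  moreover have "card A \<le> card (A - {x}) + 1"
    by (metis Suc_eq_plus1 card_Suc_Diff1 eq_imp_le finite_subset A(1)
        assms finite_insert le_add1 Diff_empty Diff_insert0)
  ultimately show ?thesis using A by simp
qed

lemma max_free_scale:
  assumes "0 < m" "finite X"
  shows "max_free s ((*) m ` X) = max_free s X"
proof -
  have inj: "inj_on ((*) m) Y" for Y :: "nat set" using assms by (simp add: inj_on_def)
  have "{card A | A. A \<subseteq> (*) m ` X \<and> smooth_gp_free s A}
      = {card A | A. A \<subseteq> X \<and> smooth_gp_free s A}"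
    (is "?L = ?R")
  proof (intro subset_antisym subsetI)
    fix n assume "n \<in> ?L"
    then obtain A where A: "n = card A" "A \<subseteq> (*) m ` X" "smooth_gp_free s A" by blast
    then obtain B where B: "B \<subseteq> X" "A = (*) m ` B" by (meson subset_imageE)
    hence "card B = n" using A inj by (simp add: card_image)
    thus "n \<in> ?R" using A B smooth_gp_free_scale[OF assms(1)] by blast
  next
    fix n assume "n \<in> ?R"
    then obtain A where A: "n = card A" "A \<subseteq> X" "smooth_gp_free s A" by blast
    have "card ((*) m ` A) = n" using A inj by (simp add: card_image)
    thus "n \<in> ?L" using A smooth_gp_free_scale[OF assms(1)] by blast
  qed
  thus ?thesis by (simp add: max_free_def)
qed

text \<open>Restricting an optimal set to the pieces gives the upper bound. Conversely, by
  \<open>sep\<close> a progression of smooth ratio stays in the piece of its first term, so optimal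
  sets chosen independently have a progression-free union.\<close>

lemma max_free_UN:
  assumes fin: "finite I" "\<And>i. i \<in> I \<Longrightarrow> finite (X i)" and disj: "disjoint_family_on X I"
    and sep: "\<And>k a b c i. \<lbrakk>ratio_primes_le s k; geom_prog3 k a b c; i \<in> I; a \<in> X i;
      b \<in> (\<Union>i\<in>I. X i); c \<in> (\<Union>i\<in>I. X i)\<rbrakk> \<Longrightarrow> b \<in> X i \<and> c \<in> X i"
  shows "max_free s (\<Union>i\<in>I. X i) = (\<Sum>i\<in>I. max_free s (X i))"
proof (rule antisym)
  obtain A where A: "A \<subseteq> (\<Union>i\<in>I. X i)" "smooth_gp_free s A" "card A = max_free s (\<Union>i\<in>I. X i)"
    using fin by (metis finite_UN max_free_attained)
  have "A = (\<Union>i\<in>I. A \<inter> X i)" using A by blast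
  hence "card A \<le> (\<Sum>i\<in>I. card (A \<inter> X i))" using fin by (metis card_UN_le)
  also have "\<dots> \<le> (\<Sum>i\<in>I. max_free s (X i))"
    using fin by (intro sum_mono max_free_ge smooth_gp_free_mono[OF A(2)]) auto
  finally show "max_free s (\<Union>i\<in>I. X i) \<le> (\<Sum>i\<in>I. max_free s (X i))" using A by simp
next
  have "\<exists>A. \<forall>i\<in>I. A i \<subseteq> X i \<and> smooth_gp_free s (A i) \<and> card (A i) = max_free s (X i)"
    by (intro bchoice ballI) (metis fin(2) max_free_attained)
  then obtain A where A: "\<And>i. i \<in> I \<Longrightarrow> A i \<subseteq> X i" "\<And>i. i \<in> I \<Longrightarrow> smooth_gp_free s (A i)"
    "\<And>i. i \<in> I \<Longrightarrow> card (A i) = max_free s (X i)" by blast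
  \<comment> \<open>This recovers membership in \<open>A i\<close> from membership in
    \<open>X i\<close>, for elements already known to lie in some chosen set.\<close>
  have dA: "j = i" if "x \<in> A j" "j \<in> I" "x \<in> X i" "i \<in> I" for x i j
    using disj A(1) that unfolding disjoint_family_on_def by blast
  have "smooth_gp_free s (\<Union>i\<in>I. A i)"
    unfolding smooth_gp_free_def
  proof (intro notI, elim exE conjE bexE)
    fix k a b c
    assume *: "ratio_primes_le s k" "a \<in> (\<Union>i\<in>I. A i)" "b \<in> (\<Union>i\<in>I. A i)"
      "c \<in> (\<Union>i\<in>I. A i)" "geom_prog3 k a b c"
    then obtain i where i: "i \<in> I" "a \<in> A i" by blast
    have "b \<in> X i \<and> c \<in> X i"
      using * i A(1) by (intro sep[of k a b c i]) blast+
    hence "b \<in> A i" "c \<in> A i" using * dA i by blast+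
    thus False using A(2)[OF i(1)] i * unfolding smooth_gp_free_def by blast
  qed
  moreover have "card (\<Union>i\<in>I. A i) = (\<Sum>i\<in>I. card (A i))"
  proof (intro card_UN_disjoint ballI impI)
    show "A i \<inter> A j = {}" if "i \<in> I" "j \<in> I" "i \<noteq> j" for i j
      using that A(1) dA by blast
  qed (use fin A(1) in \<open>auto intro: finite_subset\<close>)
  moreover have "(\<Union>i\<in>I. A i) \<subseteq> (\<Union>i\<in>I. X i)" using A(1) by blast
  ultimately show "(\<Sum>i\<in>I. max_free s (X i)) \<le> max_free s (\<Union>i\<in>I. X i)"
    using A(3) fin max_free_ge[of "\<Union>i\<in>I. X i" "\<Union>i\<in>I. A i" s] by simp
qed

section \<open>Smooth and rough parts\<close>

definition smooth_nat :: "nat \<Rightarrow> nat \<Rightarrow> bool" where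
  "smooth_nat s n \<longleftrightarrow> 0 < n \<and> (\<forall>p\<in>prime_factors n. p \<le> s)"

text \<open>Coprimality to \<open>fact s\<close> says that no prime factor is at most
  \<open>s\<close>, in a form that is visibly periodic modulo \<open>fact s\<close>.\<close>

abbreviation rough_nat :: "nat \<Rightarrow> nat \<Rightarrow> bool" where
  "rough_nat s n \<equiv> coprime n (fact s)"

lemma smooth_nat_1 [simp]: "smooth_nat s (Suc 0)"
  by (simp add: smooth_nat_def)

lemma smooth_nat_mult [simp]: "smooth_nat s (a * b) \<longleftrightarrow> smooth_nat s a \<and> smooth_nat s b"
  by (auto simp: smooth_nat_def prime_factors_product)

lemma coprime_smooth_rough:
  assumes "smooth_nat s t" "rough_nat s m"
  shows "coprime t m"
proof (rule ccontr)
  assume "\<not> coprime t m"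
  then obtain p where p: "prime p" "p dvd t" "p dvd m"
    by (meson coprime_iff_gcd_eq_1 gcd_nat.bounded_iff prime_factor_nat)
  hence "p \<le> s" using assms by (auto simp: smooth_nat_def prime_factors_dvd)
  hence "p dvd fact s" using p prime_dvd_fact_iff by blast
  thus False using p assms(2) by (meson coprime_common_divisor not_prime_unit)
qed

text \<open>\<open>m\<close> divides \<open>m' * t'\<close> and is coprime to the smooth
  \<open>t'\<close>, so it divides \<open>m'\<close>; the converse is symmetric.\<close>

lemma rough_part_unique:
  assumes "m * t = m' * t'" "rough_nat s m" "rough_nat s m'" "smooth_nat s t" "smooth_nat s t'"
  shows "m = m'"
proof -
  have "m dvd m'"
    by (metis assms(1,2,5) coprime_commute coprime_dvd_mult_left_iff coprime_smooth_rough dvd_triv_left)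
  moreover have "m' dvd m"
    by (metis assms(1,3,4) coprime_commute coprime_dvd_mult_left_iff coprime_smooth_rough dvd_triv_left)
  ultimately show ?thesis by (simp add: dvd_antisym)
qed

text \<open>Primes at most \<open>s\<close> are moved one at a time from the rough candidate to the
  smooth factor.\<close>

lemma rough_smooth_exists:
  assumes "0 < n"
  shows "\<exists>m t. n = m * t \<and> rough_nat s m \<and> smooth_nat s t"
  using assms
proof (induction n rule: less_induct)
  case (less n)
  show ?case
  proof (cases "rough_nat s n")
    case True
    thus ?thesis by (intro exI[of _ n] exI[of _ 1]) auto
  next
    case False
    then obtain p where p: "prime p" "p dvd n" "p dvd fact s"
      by (meson coprime_iff_gcd_eq_1 gcd_nat.bounded_iff prime_factor_nat)
    hence ps: "p \<le> s" using prime_dvd_fact_iff by blast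
    obtain n' where n': "n = p * n'" using p by blast
    have "n' < n" "0 < n'" using less.prems p prime_gt_1_nat[of p] by (auto simp: n')
    then obtain m t where "n' = m * t" "rough_nat s m" "smooth_nat s t"
      using less.IH by blast
    moreover have "smooth_nat s p"
      using p ps by (auto simp: smooth_nat_def prime_prime_factors prime_gt_0_nat)
    ultimately show ?thesis
      by (intro exI[of _ m] exI[of _ "p * t"]) (simp add: n')
  qed
qed

definition smooth_upto :: "nat \<Rightarrow> nat \<Rightarrow> nat set" where
  "smooth_upto s x = {t\<in>{1..x}. smooth_nat s t}"

lemma finite_smooth_upto [simp]: "finite (smooth_upto s x)"
  by (simp add: smooth_upto_def)

lemma interval_rough_decomp:
  "{1..N} = (\<Union>m\<in>{m\<in>{1..N}. rough_nat s m}. (*) m ` smooth_upto s (N div m))"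
proof (intro subset_antisym subsetI)
  fix n assume n: "n \<in> {1..N}"
  then obtain m t where mt: "n = m * t" "rough_nat s m" "smooth_nat s t"
    using rough_smooth_exists[of n s] by auto
  have "0 < m" "0 < t" using n mt by (auto intro!: Nat.gr0I)
  moreover have "m \<le> N" using n mt \<open>0 < t\<close> by (metis atLeastAtMost_iff dvd_triv_left dvd_imp_le le_trans less_eq_Suc_le One_nat_def)
  moreover have "t \<le> N div m"
    using n mt \<open>0 < m\<close> by (simp add: less_eq_div_iff_mult_less_eq mult.commute)
  ultimately show "n \<in> (\<Union>m\<in>{m\<in>{1..N}. rough_nat s m}. (*) m ` smooth_upto s (N div m))"
    using mt by (intro UN_I[of m]) (auto simp: smooth_upto_def)
next
  fix n assume "n \<in> (\<Union>m\<in>{m\<in>{1..N}. rough_nat s m}. (*) m ` smooth_upto s (N div m))"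
  then show "n \<in> {1..N}"
    by (auto simp: smooth_upto_def less_eq_div_iff_mult_less_eq mult.commute Suc_le_eq)
qed

lemma disjoint_rough_parts:
  "disjoint_family_on (\<lambda>m. (*) m ` smooth_upto s (N div m)) {m\<in>{1..N}. rough_nat s m}"
  unfolding disjoint_family_on_def smooth_upto_def
  using rough_part_unique[of _ _ _ _ s] by (smt (verit) disjoint_iff imageE mem_Collect_eq)

text \<open>Multiplication by a smooth ratio preserves the rough part, so the classes of equal rough
  part \<open>m\<close> do not interact. Dividing such a class by \<open>m\<close> yields the smooth
  numbers up to \<open>N div m\<close>.\<close>

lemma g_max_decomp:
  "g_max s N = (\<Sum>m\<in>{m\<in>{1..N}. rough_nat s m}. max_free s (smooth_upto s (N div m)))"
proof -
  let ?I = "{m\<in>{1..N}. rough_nat s m}"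
  have "max_free s (\<Union>m\<in>?I. (*) m ` smooth_upto s (N div m))
      = (\<Sum>m\<in>?I. max_free s ((*) m ` smooth_upto s (N div m)))"
  proof (rule max_free_UN[OF _ _ disjoint_rough_parts])
    fix k a b c i
    assume rk: "ratio_primes_le s k" and gp: "geom_prog3 k a b c" and i: "i \<in> ?I"
      and a: "a \<in> (*) i ` smooth_upto s (N div i)"
      and bc: "b \<in> (\<Union>m\<in>?I. (*) m ` smooth_upto s (N div m))"
        "c \<in> (\<Union>m\<in>?I. (*) m ` smooth_upto s (N div m))"
    obtain u v where uv: "0 < u" "0 < v" "k = of_nat u / of_nat v" "smooth_nat s u" "smooth_nat s v"
      using rk unfolding ratio_primes_le_def smooth_nat_def by blast
    \<comment> \<open>Clearing denominators in \<open>k = u / v\<close> gives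
      \<open>y * v = x * u\<close>; as \<open>u\<close> and \<open>v\<close> are smooth, uniqueness
      identifies the rough parts of \<open>x\<close> and \<open>y\<close>.\<close>
    have step: "y \<in> (*) i ` smooth_upto s (N div i)"
      if xy: "(of_nat y :: rat) = of_nat x * k" and x: "x \<in> (*) i ` smooth_upto s (N div i)"
        and y: "y \<in> (\<Union>m\<in>?I. (*) m ` smooth_upto s (N div m))" for x y
    proof -
      obtain j where j: "j \<in> ?I" "y \<in> (*) j ` smooth_upto s (N div j)" using y by blast
      then obtain t where t: "y = j * t" "smooth_nat s t" by (auto simp: smooth_upto_def)
      obtain r where r: "x = i * r" "smooth_nat s r" using x by (auto simp: smooth_upto_def)
      have "(of_nat (y * v) :: rat) = of_nat (x * u)" using xy uv by (simp add: field_simps)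
      hence "y * v = x * u" using of_nat_eq_iff by blast
      hence "j * (t * v) = i * (r * u)" by (simp add: t r mult.assoc)
      hence "j = i"
        using i j uv t r by (intro rough_part_unique[of j "t * v" i "r * u" s]) auto
      thus ?thesis using j by simp
    qed
    have b: "b \<in> (*) i ` smooth_upto s (N div i)"
      using gp a bc by (intro step[of b a]) (auto simp: geom_prog3_def)
    moreover have "c \<in> (*) i ` smooth_upto s (N div i)"
      using gp b bc by (intro step[of c b]) (auto simp: geom_prog3_def power2_eq_square)
    ultimately show "b \<in> (*) i ` smooth_upto s (N div i) \<and> c \<in> (*) i ` smooth_upto s (N div i)" ..
  qed auto
  also have "\<dots> = (\<Sum>m\<in>?I. max_free s (smooth_upto s (N div m)))"
    by (intro sum.cong refl max_free_scale) auto
  finally show ?thesis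
    unfolding g_max_eq interval_rough_decomp[of N s, symmetric] .
qed

section \<open>Existence of the limit\<close>

definition rough_count :: "nat \<Rightarrow> nat \<Rightarrow> nat" where
  "rough_count s x = card {m\<in>{1..x}. rough_nat s m}"

lemma rough_count_0 [simp]: "rough_count s 0 = 0"
  by (simp add: rough_count_def)

lemma rough_count_le: "rough_count s x \<le> x"
  unfolding rough_count_def by (rule order.trans[OF card_mono[of "{1..x}"]]) auto

lemma rough_count_Suc: "rough_count s (Suc x) = rough_count s x + of_bool (rough_nat s (Suc x))"
proof -
  have "{m\<in>{1..Suc x}. rough_nat s m}
      = (if rough_nat s (Suc x) then insert (Suc x) {m\<in>{1..x}. rough_nat s m}
         else {m\<in>{1..x}. rough_nat s m})"
    by (auto simp: le_Suc_eq)
  thus ?thesis by (simp add: rough_count_def)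
qed

text \<open>Being rough depends only on the residue modulo \<open>fact s\<close>, and any shift by a
  full period adds the count of one period.\<close>

lemma rough_count_add_fact: "rough_count s (x + fact s) = rough_count s x + rough_count s (fact s)"
proof (induction x)
  case (Suc x)
  have "rough_nat s (Suc (x + fact s)) \<longleftrightarrow> rough_nat s (Suc x)"
    using gcd_add1[of "Suc x" "fact s :: nat"] by (simp add: coprime_iff_gcd_eq_1)
  thus ?case using Suc by (simp add: rough_count_Suc)
qed auto

lemma rough_count_fact_mult: "rough_count s (fact s * k) = rough_count s (fact s) * k"
  by (induction k) (simp_all add: rough_count_add_fact add.commute[of "fact s"])

text \<open>The proportion of units modulo s!, that is, Euler's phi(s!) / s!.\<close>

definition rough_density :: "nat \<Rightarrow> real" where
  "rough_density s = real (rough_count s (fact s)) / fact s"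

lemma rough_density_bounds: "0 < rough_density s" "rough_density s \<le> 1"
proof -
  have "card {1::nat} \<le> rough_count s (fact s)"
    unfolding rough_count_def by (intro card_mono) (auto simp: Suc_le_eq)
  thus "0 < rough_density s" by (simp add: rough_density_def)
  have "real (rough_count s (fact s)) \<le> real (fact s)"
    using rough_count_le of_nat_le_iff by blast
  thus "rough_density s \<le> 1" by (simp add: rough_density_def)
qed

text \<open>The error does not change when a full period is removed, which reduces to
  \<open>x < fact s\<close>; there both quantities lie between 0 and \<open>x\<close>.\<close>

lemma rough_count_approx: "\<bar>real (rough_count s x) - rough_density s * x\<bar> \<le> fact s"
proof (induction x rule: less_induct)
  case (less x)
  show ?case
  proof (cases "x < fact s")
    case True
    have "real x \<le> fact s" using True by (metis less_imp_le of_nat_fact of_nat_le_iff)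
    moreover have "real (rough_count s x) \<le> x" using rough_count_le by simp
    moreover have "0 \<le> rough_density s * x" "rough_density s * x \<le> x"
      using rough_density_bounds[of s] by (simp_all add: mult_left_le_one_le)
    ultimately show ?thesis by simp
  next
    case False
    then obtain y where y: "x = y + fact s" by (metis le_add_diff_inverse2 not_le)
    have "rough_density s * fact s = rough_count s (fact s)" by (simp add: rough_density_def)
    hence "real (rough_count s x) - rough_density s * x = real (rough_count s y) - rough_density s * y"
      by (simp add: y rough_count_add_fact algebra_simps)
    thus ?thesis using less.IH[of y] by (simp add: y)
  qed
qed

text \<open>Rounding \<open>N / n\<close> costs at most 1 and counting costs at most
  \<open>fact s\<close>, so the error after division by \<open>N\<close> is O(1/N). For
  \<open>n = 0\<close> both sides are 0 by the conventions on division.\<close>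

lemma rough_count_div_LIMSEQ:
  "(\<lambda>N. real (rough_count s (N div n)) / N) \<longlonglongrightarrow> rough_density s / n"
proof (cases "n = 0")
  case False
  have "(\<lambda>N. real (rough_count s (N div n)) / N - rough_density s / n) \<longlonglongrightarrow> 0"
  proof (rule Lim_null_comparison)
    have "norm (real (rough_count s (N div n)) / N - rough_density s / n) \<le> (fact s + 1) / N"
      if "0 < N" for N
    proof -
      let ?q = "real (N div n)"
      have "?q \<le> N / n" by (simp add: of_nat_div_le_of_nat)
      moreover have "real N / n \<le> ?q + 1"
        by (metis floor_divide_of_nat_eq of_int_of_nat_eq real_of_int_floor_add_one_ge)
      ultimately have "0 \<le> N / n - ?q" "N / n - ?q \<le> 1" by auto
      hence "\<bar>rough_density s * (?q - N / n)\<bar> \<le> 1 * 1"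
        unfolding abs_mult using rough_density_bounds[of s] by (intro mult_mono) auto
      moreover have "\<bar>real (rough_count s (N div n)) - rough_density s * ?q\<bar> \<le> fact s"
        by (rule rough_count_approx)
      ultimately have "\<bar>real (rough_count s (N div n)) - rough_density s * (N / n)\<bar> \<le> fact s + 1"
        by (simp add: algebra_simps)
      moreover have "real (rough_count s (N div n)) / N - rough_density s / n
          = (real (rough_count s (N div n)) - rough_density s * (N / n)) / N"
        using that by (simp add: field_simps)
      ultimately show ?thesis using that by (simp add: divide_right_mono)
    qed
    thus "\<forall>\<^sub>F N in sequentially.
        norm (real (rough_count s (N div n)) / N - rough_density s / n) \<le> (fact s + 1) / N"
      using eventually_gt_at_top[of "0::nat"] by (rule eventually_mono[rotated])
    show "(\<lambda>N. (fact s + 1) / real N) \<longlonglongrightarrow> 0"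
      by (rule tendsto_divide_0[OF tendsto_const]) (simp add: filterlim_real_sequentially filterlim_at_top_imp_at_infinity)
  qed
  thus ?thesis by (simp add: LIM_zero_iff)
qed auto

text \<open>Both sides sum \<open>c n\<close> over the pairs with \<open>m\<close> rough and
  \<open>m * n \<le> N\<close>. The weight \<open>c\<close> is later the indicator of smooth numbers
  and then \<open>jump s\<close>.\<close>

lemma sum_rough_swap:
  "(\<Sum>m\<in>{m\<in>{1..N}. rough_nat s m}. \<Sum>n\<in>{1..N div m}. c n)
    = (\<Sum>n\<in>{1..N}. c n * rough_count s (N div n))" for c :: "nat \<Rightarrow> nat"
proof -
  let ?I = "{m\<in>{1..N}. rough_nat s m}"
  have "(\<Sum>m\<in>?I. \<Sum>n\<in>{1..N div m}. c n) = (\<Sum>m\<in>?I. \<Sum>n\<in>{n\<in>{1..N}. m * n \<le> N}. c n)"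
  proof (intro sum.cong refl)
    fix m assume m: "m \<in> ?I"
    have "n \<le> N" if "m * n \<le> N" for n
      using m that by (metis (no_types, lifting) atLeastAtMost_iff le_trans mem_Collect_eq mult_le_mono1 nat_mult_1)
    thus "{1..N div m} = {n\<in>{1..N}. m * n \<le> N}"
      using m by (auto simp: less_eq_div_iff_mult_less_eq mult.commute)
  qed
  also have "\<dots> = (\<Sum>n\<in>{1..N}. \<Sum>m\<in>{m\<in>?I. m * n \<le> N}. c n)"
    by (rule sum.swap_restrict) auto
  also have "\<dots> = (\<Sum>n\<in>{1..N}. c n * rough_count s (N div n))"
  proof (intro sum.cong refl)
    fix n assume n: "n \<in> {1..N}"
    have "m \<le> N" if "m * n \<le> N" for m
      using n that by (metis atLeastAtMost_iff le_trans mult_le_mono2 nat_mult_1_right)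
    hence "{m\<in>?I. m * n \<le> N} = {m\<in>{1..N div n}. rough_nat s m}"
      using n by (auto simp: less_eq_div_iff_mult_less_eq)
    thus "(\<Sum>m\<in>{m\<in>?I. m * n \<le> N}. c n) = c n * rough_count s (N div n)"
      by (simp add: rough_count_def)
  qed
  finally show ?thesis .
qed

lemma card_smooth_upto: "card (smooth_upto s x) = (\<Sum>n\<in>{1..x}. of_bool (smooth_nat s n))"
  by (simp add: smooth_upto_def Int_def)

text \<open>Every number up to \<open>N\<close> is counted once, through its factorization into a
  rough and a smooth part.\<close>

lemma sum_smooth_rough_count:
  "(\<Sum>n\<in>{1..N}. of_bool (smooth_nat s n) * rough_count s (N div n)) = N"
proof -
  let ?I = "{m\<in>{1..N}. rough_nat s m}"
  have "N = card (\<Union>m\<in>?I. (*) m ` smooth_upto s (N div m))"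
    unfolding interval_rough_decomp[of N s, symmetric] by simp
  also have "\<dots> = (\<Sum>m\<in>?I. card ((*) m ` smooth_upto s (N div m)))"
    by (rule card_UN_disjoint'[OF disjoint_rough_parts]) auto
  also have "\<dots> = (\<Sum>m\<in>?I. card (smooth_upto s (N div m)))"
    by (intro sum.cong refl card_image) (auto simp: inj_on_def)
  also have "\<dots> = (\<Sum>n\<in>{1..N}. of_bool (smooth_nat s n) * rough_count s (N div n))"
    unfolding card_smooth_upto by (rule sum_rough_swap)
  finally show ?thesis ..
qed

text \<open>No Euler product is needed: the sets of rough multiples of distinct smooth \<open>n\<close> are disjoint and
  have density \<open>rough_density s / n\<close>, so these densities sum to at most 1.\<close>
lemma summable_smooth_reciprocals: "summable (\<lambda>n. of_bool (smooth_nat s n) / real n)"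
proof (rule bounded_imp_summable)
  fix K
  \<comment> \<open>Each positive \<open>n \<le> K\<close> divides \<open>fact K\<close>, so
    \<open>N div n\<close> is a multiple of the period \<open>fact s\<close> and its rough count is
    exactly \<open>rough_density s * N / n\<close>, without error term.\<close>
  define N :: nat where "N = fact s * fact K"
  have "rough_density s * N * (\<Sum>n\<le>K. of_bool (smooth_nat s n) / real n)
      = (\<Sum>n\<le>K. of_bool (smooth_nat s n) * real (rough_count s (N div n)))"
    unfolding sum_distrib_left
  proof (intro sum.cong refl)
    fix n assume n: "n \<in> {..K}"
    show "rough_density s * N * (of_bool (smooth_nat s n) / real n)
        = of_bool (smooth_nat s n) * real (rough_count s (N div n))"
    proof (cases "n = 0")
      case False
      hence "n dvd fact K" using n by (auto intro: dvd_fact)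
      then obtain q where q: "fact K = n * q" by blast
      have "N div n = fact s * q" using False by (simp add: N_def q)
      thus ?thesis
        using False by (simp add: rough_count_fact_mult rough_density_def N_def q)
    qed auto
  qed
  also have "\<dots> \<le> (\<Sum>n\<in>{..N}. of_bool (smooth_nat s n) * real (rough_count s (N div n)))"
  proof (intro sum_mono2)
    have "K \<le> fact K" by (rule fact_ge_self)
    also have "\<dots> \<le> N" by (simp add: N_def)
    finally show "{..K} \<subseteq> {..N}" by simp
  qed auto
  also have "\<dots> = real (\<Sum>n\<in>{1..N}. of_bool (smooth_nat s n) * rough_count s (N div n))"
    unfolding of_nat_sum by (rule sum.mono_neutral_cong_right) (auto simp: smooth_nat_def Suc_le_eq)
  also have "\<dots> = N" by (simp only: sum_smooth_rough_count)
  finally have "rough_density s * (\<Sum>n\<le>K. of_bool (smooth_nat s n) / real n) * N \<le> 1 * real N"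
    by (simp add: mult_ac)
  moreover have "0 < real N" by (simp add: N_def)
  ultimately have "rough_density s * (\<Sum>n\<le>K. of_bool (smooth_nat s n) / real n) \<le> 1"
    by (simp only: mult_le_cancel_right_pos)
  thus "(\<Sum>n\<le>K. of_bool (smooth_nat s n) / real n) \<le> 1 / rough_density s"
    using rough_density_bounds[of s] by (simp add: field_simps)
qed auto

text \<open>The truncated subtraction is exact because \<open>max_free\<close> is monotone, so jumps
  telescope; at \<open>n = 0\<close> the value is 0.\<close>

definition jump :: "nat \<Rightarrow> nat \<Rightarrow> nat" where
  "jump s n = max_free s (smooth_upto s n) - max_free s (smooth_upto s (n - 1))"

lemma max_free_smooth_upto: "max_free s (smooth_upto s x) = (\<Sum>n\<in>{1..x}. jump s n)"
proof (induction x)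
  case 0
  show ?case using max_free_attained[of "{}" s] by (auto simp: smooth_upto_def)
next
  case (Suc x)
  have "max_free s (smooth_upto s x) \<le> max_free s (smooth_upto s (Suc x))"
    by (rule max_free_mono) (auto simp: smooth_upto_def)
  thus ?case using Suc by (simp add: jump_def)
qed

lemma jump_le: "jump s n \<le> of_bool (smooth_nat s n)"
proof (cases "n = 0")
  case False
  have "smooth_upto s n = (if smooth_nat s n then insert n (smooth_upto s (n - 1))
      else smooth_upto s (n - 1))"
    using False by (auto simp: smooth_upto_def le_eq_less_or_eq)
  thus ?thesis
    using max_free_insert_le[of "smooth_upto s (n - 1)" s n] by (auto simp: jump_def)
qed (simp add: jump_def)

lemma g_max_eq_sum: "g_max s N = (\<Sum>n\<in>{1..N}. jump s n * rough_count s (N div n))"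
  unfolding g_max_decomp max_free_smooth_upto by (rule sum_rough_swap)

text \<open>Tannery's theorem allows the limit to be taken term by term in the sum over jumps: the
  terms are dominated by the reciprocals of smooth numbers, whose sum converges.\<close>

lemma g_max_LIMSEQ: "(\<lambda>N. real (g_max s N) / N) \<longlonglongrightarrow> alpha_bar_smooth s"
proof -
  define a where "a n N = jump s n * (real (rough_count s (N div n)) / N)" for n N
  have "(\<lambda>N. \<Sum>n. a n N) \<longlonglongrightarrow> (\<Sum>n. jump s n * (rough_density s / n))"
  proof (rule tannerys_theorem[THEN conjunct2, THEN conjunct2])
    show "(\<lambda>N. a n N) \<longlonglongrightarrow> jump s n * (rough_density s / n)" for n
      unfolding a_def by (intro tendsto_mult_left rough_count_div_LIMSEQ)
    have "norm (a n N) \<le> of_bool (smooth_nat s n) / real n" for n N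
    proof -
      have "real (rough_count s (N div n)) \<le> real (N div n)"
        using rough_count_le by simp
      also have "\<dots> \<le> N / n" by (simp add: of_nat_div_le_of_nat)
      finally have "real (rough_count s (N div n)) / N \<le> 1 / n"
        by (cases "N = 0") (auto simp: field_simps)
      moreover have "real (jump s n) \<le> of_bool (smooth_nat s n)"
        using jump_le by (metis of_nat_le_iff of_nat_of_bool)
      ultimately have "real (jump s n) * (real (rough_count s (N div n)) / N)
          \<le> of_bool (smooth_nat s n) * (1 / n)"
        by (intro mult_mono) auto
      thus ?thesis by (simp add: a_def)
    qed
    thus "\<forall>\<^sub>F (n, N) in sequentially \<times>\<^sub>F sequentially. norm (a n N) \<le> of_bool (smooth_nat s n) / real n"
      by (intro always_eventually) auto
  qed (auto intro: summable_smooth_reciprocals)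
  moreover have "(\<Sum>n. a n N) = real (g_max s N) / N" for N
  proof -
    \<comment> \<open>Terms with \<open>n > N\<close> vanish because \<open>N div n = 0\<close> and
      \<open>rough_count s 0 = 0\<close>.\<close>
    have "(\<Sum>n. a n N) = (\<Sum>n\<in>{1..N}. a n N)"
    proof (rule suminf_finite)
      fix n assume "n \<notin> {1..N}"
      hence "N div n = 0" by (cases "n = 0") auto
      thus "a n N = 0" by (simp add: a_def)
    qed auto
    thus ?thesis by (simp add: g_max_eq_sum a_def sum_divide_distrib)
  qed
  \<comment> \<open>As \<open>alpha_bar_smooth\<close> is defined by \<open>lim\<close>, convergence
    to any value suffices.\<close>
  ultimately have "convergent (\<lambda>N. real (g_max s N) / N)"
    by (simp add: convergent_def) blast
  thus ?thesis by (simp add: convergent_LIMSEQ_iff alpha_bar_smooth_def)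
qed

section \<open>Comparison with the unrestricted problem\<close>

lemma gp_free_imp_smooth_gp_free: "gp_free A \<Longrightarrow> smooth_gp_free s A"
  unfolding gp_free_def smooth_gp_free_def by blast

text \<open>Each initial segment of a progression-free set competes in the maximum
  \<open>g_max s N\<close>.\<close>

lemma alpha_bar_le: "alpha_bar \<le> ereal (alpha_bar_smooth s)"
  unfolding alpha_bar_def
proof (rule Sup_least, clarify)
  fix A assume A: "gp_free A"
  have "limsup (\<lambda>N. ereal (real (card (A \<inter> {1..N})) / N)) \<le> limsup (\<lambda>N. ereal (real (g_max s N) / N))"
  proof (intro Limsup_mono always_eventually allI)
    fix N
    have "smooth_gp_free s (A \<inter> {1..N})"
      using A gp_free_imp_smooth_gp_free smooth_gp_free_mono by blast
    hence "card (A \<inter> {1..N}) \<le> g_max s N"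
      unfolding g_max_eq by (intro max_free_ge) auto
    thus "ereal (real (card (A \<inter> {1..N})) / N) \<le> ereal (real (g_max s N) / N)"
      by (simp add: divide_right_mono)
  qed
  also have "\<dots> = ereal (alpha_bar_smooth s)"
    by (intro lim_imp_Limsup) (auto intro: g_max_LIMSEQ)
  finally show "upper_density A \<le> ereal (alpha_bar_smooth s)"
    by (simp add: upper_density_def)
qed

section \<open>Numbers with a large square divisor\<close>

lemma sum_inverse_squares_le:
  assumes "0 < s" "s \<le> n"
  shows "(\<Sum>u\<in>{s<..n}. 1 / real u ^ 2) \<le> 1 / s - 1 / n"
  using assms(2)
proof (induction n rule: dec_induct)
  case (step n)
  have "{s<..Suc n} = insert (Suc n) {s<..n}" using step by auto
  \<comment> \<open>Comparison with 1/(n(n+1)) makes the sum telescope.\<close>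
  moreover have "1 / real (Suc n) ^ 2 \<le> 1 / n - 1 / Suc n"
  proof -
    have "1 / real (Suc n) ^ 2 \<le> 1 / (real n * real (Suc n))"
      unfolding power2_eq_square using step assms(1) by (intro divide_left_mono mult_right_mono) auto
    also have "\<dots> = 1 / n - 1 / Suc n" using step assms(1) by (simp add: field_simps)
    finally show ?thesis .
  qed
  ultimately show ?case using step by simp
qed auto

lemma card_multiples_le: "card {n\<in>{1..N}. d dvd n} \<le> N div d"
proof -
  have "{n\<in>{1..N}. d dvd n} \<subseteq> (*) d ` {1..N div d}"
  proof clarify
    fix n assume "n \<in> {1..N}" "d dvd n"
    then obtain q where "n = d * q" "0 < d" "0 < q" "n \<le> N" by (auto intro!: Nat.gr0I)
    thus "n \<in> (*) d ` {1..N div d}"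
      by (intro image_eqI[of _ _ q]) (auto simp: less_eq_div_iff_mult_less_eq mult.commute)
  qed
  hence "card {n\<in>{1..N}. d dvd n} \<le> card ((*) d ` {1..N div d})" by (intro card_mono) auto
  also have "\<dots> \<le> card {1..N div d}" by (rule card_image_le) auto
  finally show ?thesis by simp
qed

text \<open>A union bound over \<open>u\<close>: only \<open>u \<le> N\<close> can occur since
  \<open>u \<le> u^2 \<le> n\<close>, and the reciprocals of the squares beyond \<open>s\<close> sum
  to at most 1/s.\<close>

lemma card_large_square_divisor_le:
  fixes s N :: nat
  assumes "0 < s"
  shows "real (card {n\<in>{1..N}. \<exists>u>s. u^2 dvd n}) \<le> N / s"
proof -
  have "{n\<in>{1..N}. \<exists>u>s. u^2 dvd n} \<subseteq> (\<Union>u\<in>{s<..N}. {n\<in>{1..N}. u^2 dvd n})"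
  proof clarify
    fix n u assume *: "n \<in> {1..N}" "s < u" "u^2 dvd n"
    have "u \<le> u^2" by (rule self_le_power) (use * in auto)
    also have "\<dots> \<le> n" using * by (intro dvd_imp_le) auto
    finally show "n \<in> (\<Union>u\<in>{s<..N}. {n\<in>{1..N}. u^2 dvd n})" using * by auto
  qed
  hence "card {n\<in>{1..N}. \<exists>u>s. u^2 dvd n} \<le> card (\<Union>u\<in>{s<..N}. {n\<in>{1..N}. u^2 dvd n})"
    by (intro card_mono) auto
  also have "\<dots> \<le> (\<Sum>u\<in>{s<..N}. card {n\<in>{1..N}. u^2 dvd n})" by (rule card_UN_le) auto
  also have "\<dots> \<le> (\<Sum>u\<in>{s<..N}. N div u^2)" by (intro sum_mono card_multiples_le)
  finally have "real (card {n\<in>{1..N}. \<exists>u>s. u^2 dvd n}) \<le> real (\<Sum>u\<in>{s<..N}. N div u^2)"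
    by (simp only: of_nat_le_iff)
  also have "\<dots> = (\<Sum>u\<in>{s<..N}. real (N div u^2))" by simp
  also have "\<dots> \<le> (\<Sum>u\<in>{s<..N}. N * (1 / real u ^ 2))"
    by (intro sum_mono) (metis of_nat_div_le_of_nat of_nat_power times_divide_eq_right mult.right_neutral)
  also have "\<dots> = N * (\<Sum>u\<in>{s<..N}. 1 / real u ^ 2)" by (simp add: sum_distrib_left)
  also have "\<dots> \<le> N * (1 / s)"
  proof (rule mult_left_mono)
    show "(\<Sum>u\<in>{s<..N}. 1 / real u ^ 2) \<le> 1 / s"
    proof (cases "s \<le> N")
      case True
      have "0 \<le> 1 / real N" by simp
      thus ?thesis using sum_inverse_squares_le[OF assms True] by linarith
    qed simp
  qed auto
  finally show ?thesis by simp
qed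

text \<open>Optimal sets for \<open>N = (i + 1)!\<close> are cut down to the blocks \<open>(s \<cdot> i!, (i + 1)!]\<close>. Numbers without
  square divisors \<open>u\<^sup>2\<close>, \<open>u > s\<close>, only form progressions of ratio at most \<open>s\<close>, which cannot leap from
  one block to the next.\<close>
lemma alpha_bar_ge:
  assumes s: "0 < s"
  shows "ereal (alpha_bar_smooth s - 1 / s) \<le> alpha_bar"
proof -
  have "\<exists>S. \<forall>N. S N \<subseteq> {1..N} \<and> smooth_gp_free s (S N) \<and> card (S N) = g_max s N"
    unfolding g_max_eq by (intro choice allI) (metis finite_atLeastAtMost max_free_attained)
  then obtain S where S: "\<And>N. S N \<subseteq> {1..N}" "\<And>N. smooth_gp_free s (S N)"
    "\<And>N. card (S N) = g_max s N" by blast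
  define D where "D = {n. \<exists>u>s. u^2 dvd n}"
  define B where "B i = (S (fact (Suc i)) \<inter> {s * fact i<..fact (Suc i)}) - D" for i
  define A where "A = (\<Union>i. B i)"
  \<comment> \<open>A later block starts above \<open>s\<close> times the end of the block of
    \<open>x\<close>, beyond the reach of \<open>y \<le> s * x\<close>; an earlier block lies
    entirely below \<open>x\<close>. Blocks with \<open>i < s\<close> are empty.\<close>
  have same_block: "i = j" if "x \<in> B i" "y \<in> B j" "x < y" "y \<le> s * x" for i j x y
  proof (rule ccontr)
    assume "i \<noteq> j"
    hence "Suc i \<le> j \<or> Suc j \<le> i" by linarith
    thus False
    proof
      assume "Suc i \<le> j"
      have "y \<le> s * x" by fact
      also have "\<dots> \<le> s * fact (Suc i)" using that by (intro mult_le_mono2) (auto simp: B_def)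
      also have "\<dots> \<le> s * fact j" using \<open>Suc i \<le> j\<close> by (intro mult_le_mono2 fact_mono_nat)
      also have "\<dots> < y" using that by (auto simp: B_def)
      finally show False by simp
    next
      assume "Suc j \<le> i"
      have "y \<le> fact (Suc j)" using that by (auto simp: B_def)
      also have "\<dots> \<le> fact i" using \<open>Suc j \<le> i\<close> by (intro fact_mono_nat)
      also have "\<dots> \<le> s * fact i" using s by simp
      also have "\<dots> < x" using that by (auto simp: B_def)
      finally show False using that by simp
    qed
  qed
  have "gp_free A"
    unfolding gp_free_def
  proof (intro notI, elim exE bexE)
    fix k a b c assume abc: "a \<in> A" "b \<in> A" "c \<in> A" and gp: "geom_prog3 k a b c"
    obtain m u v where muv: "0 < m" "0 < v" "v < u" "k = of_nat u / of_nat v"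
      "a = m * v^2" "b = m * u * v" "c = m * u^2"
      using geom_prog3_normal_form[OF gp] .
    \<comment> \<open>The third term \<open>m * u^2\<close> is outside \<open>D\<close>. As
      \<open>v < u\<close>, all primes in the ratio are then at most \<open>s\<close>.\<close>
    have "u \<le> s" using abc(3) muv by (auto simp: A_def B_def D_def not_less)
    have "p \<le> s" if "p \<in> prime_factors x" "0 < x" "x \<le> s" for p x
      using that dvd_imp_le[of p x] by auto
    hence k: "ratio_primes_le s k"
      unfolding ratio_primes_le_def using muv \<open>u \<le> s\<close>
      by (intro exI[of _ u] exI[of _ v]) auto
    obtain i where i: "a \<in> B i" using abc by (auto simp: A_def)
    obtain j where j: "b \<in> B j" using abc by (auto simp: A_def)
    obtain l where l: "c \<in> B l" using abc by (auto simp: A_def)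
    have "i = j"
    proof (rule same_block[OF i j])
      show "a < b" using muv by (simp add: power2_eq_square)
      \<comment> \<open>Since \<open>1 \<le> v\<close>, the ratio \<open>u / v\<close> is at most
        \<open>u\<close>, hence at most \<open>s\<close>.\<close>
      have "b = u * (m * v * 1)" using muv by simp
      also have "\<dots> \<le> s * (m * v * v)"
        using muv \<open>u \<le> s\<close> by (intro mult_le_mono) auto
      finally show "b \<le> s * a" using muv by (simp add: power2_eq_square mult_ac)
    qed
    moreover have "j = l"
    proof (rule same_block[OF j l])
      show "b < c" using muv by (simp add: power2_eq_square)
      have "c = u * (m * u * 1)" using muv by (simp add: power2_eq_square)
      also have "\<dots> \<le> s * (m * u * v)"
        using muv \<open>u \<le> s\<close> by (intro mult_le_mono) auto
      finally show "c \<le> s * b" using muv by simp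
    qed
    ultimately have "{a, b, c} \<subseteq> S (fact (Suc i))" using i j l by (auto simp: B_def)
    thus False using S(2) k gp unfolding smooth_gp_free_def by blast
  qed
  moreover have "A \<subseteq> {1..}" using S(1) by (fastforce simp: A_def B_def)
  ultimately have "upper_density A \<le> alpha_bar"
    unfolding alpha_bar_def by (intro Sup_upper) blast
  moreover have "ereal (alpha_bar_smooth s - 1 / s) \<le> upper_density A"
  proof -
    \<comment> \<open>These are the right ends of the blocks; beginning with 1! keeps
      \<open>r\<close> strictly increasing, since 0! = 1!.\<close>
    define r :: "nat \<Rightarrow> nat" where "r i = fact (Suc i)" for i
    have r: "strict_mono r" unfolding strict_mono_Suc_iff r_def by (simp add: fact_less_mono_nat)
    define f where "f N = real (card (A \<inter> {1..N})) / N" for N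
    \<comment> \<open>Two losses occur in passing from \<open>S (r i)\<close> to \<open>A\<close>:
      the elements up to \<open>s * fact i\<close>, a share of at most \<open>s / Suc i\<close>,
      which tends to 0, and those in \<open>D\<close>, a share of at most
      \<open>1 / s\<close>.\<close>
    have lower: "real (g_max s (r i)) / r i - 1 / s - s / Suc i \<le> f (r i)" for i
    proof -
      have "S (r i) \<subseteq> (A \<inter> {1..r i}) \<union> {1..s * fact i} \<union> {n\<in>{1..r i}. \<exists>u>s. u^2 dvd n}"
        using S(1)[of "r i"] by (auto simp: A_def B_def D_def r_def subset_iff)
      hence "card (S (r i)) \<le> card ((A \<inter> {1..r i}) \<union> {1..s * fact i} \<union> {n\<in>{1..r i}. \<exists>u>s. u^2 dvd n})"
        by (intro card_mono) auto
      also have "\<dots> \<le> card (A \<inter> {1..r i}) + card {1..s * fact i} + card {n\<in>{1..r i}. \<exists>u>s. u^2 dvd n}"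
        by (meson add_le_mono card_Un_le le_trans order_refl)
      finally have "real (g_max s (r i)) \<le> real (card (A \<inter> {1..r i}) + card {1..s * fact i}
          + card {n\<in>{1..r i}. \<exists>u>s. u^2 dvd n})"
        unfolding S(3) of_nat_le_iff .
      also have "\<dots> \<le> real (card (A \<inter> {1..r i})) + s * fact i + r i / s"
        using card_large_square_divisor_le[OF s, of "r i"] by simp
      finally have "real (g_max s (r i)) / r i \<le> (real (card (A \<inter> {1..r i})) + s * fact i + r i / s) / r i"
        by (rule divide_right_mono) simp
      also have "\<dots> = f (r i) + s / Suc i + 1 / s"
      proof -
        have "real (r i) = real (Suc i) * fact i" "real (r i) \<noteq> 0"
          by (simp add: r_def algebra_simps) (simp add: r_def del: fact_Suc)
        hence "s * fact i / r i = s / Suc i" "r i / s / r i = 1 / s"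
          using s by (simp_all del: of_nat_Suc)
        thus ?thesis by (simp add: f_def add_divide_distrib del: of_nat_Suc)
      qed
      finally show ?thesis by simp
    qed
    have "(\<lambda>i. real (g_max s (r i)) / r i - 1 / s - s / Suc i) \<longlonglongrightarrow> alpha_bar_smooth s - 1 / s - 0"
      using LIMSEQ_subseq_LIMSEQ[OF g_max_LIMSEQ r, of s]
      by (intro tendsto_diff tendsto_const LIMSEQ_Suc[OF lim_const_over_n]) (simp add: o_def)
    hence "ereal (alpha_bar_smooth s - 1 / s)
        = limsup (\<lambda>i. ereal (real (g_max s (r i)) / r i - 1 / s - s / Suc i))"
      by (intro lim_imp_Limsup[symmetric]) auto
    also have "\<dots> \<le> limsup ((\<lambda>N. ereal (f N)) \<circ> r)"
      using lower by (intro Limsup_mono always_eventually) auto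
    also have "\<dots> \<le> limsup (\<lambda>N. ereal (f N))" by (rule limsup_subseq_mono[OF r])
    finally show ?thesis by (simp add: upper_density_def f_def)
  qed
  ultimately show ?thesis by (rule order.trans[rotated])
qed

theorem theorem5p1:
  shows "(\<lambda>s. ereal (alpha_bar_smooth s)) \<longlonglongrightarrow> alpha_bar"
proof -
  \<comment> \<open>Finiteness of \<open>alpha_bar\<close> moves both comparisons to the reals,
    where the sandwich applies.\<close>
  have "alpha_bar \<noteq> \<infinity>" using alpha_bar_le[of 1] by force
  moreover have "alpha_bar \<noteq> -\<infinity>"
    using alpha_bar_ge[OF zero_less_one] by (metis MInfty_neq_ereal(1) ereal_infty_less_eq(2))
  ultimately obtain \<alpha> where \<alpha>: "alpha_bar = ereal \<alpha>" by (cases alpha_bar) auto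
  have "alpha_bar_smooth \<longlonglongrightarrow> \<alpha>"
  proof (rule tendsto_sandwich)
    show "\<forall>\<^sub>F s in sequentially. \<alpha> \<le> alpha_bar_smooth s"
      using alpha_bar_le by (simp add: \<alpha>)
    have "alpha_bar_smooth s \<le> \<alpha> + 1 / s" if "0 < s" for s
      using alpha_bar_ge[OF that] by (simp add: \<alpha>)
    thus "\<forall>\<^sub>F s in sequentially. alpha_bar_smooth s \<le> \<alpha> + 1 / s"
      using eventually_gt_at_top[of "0::nat"] by (rule eventually_mono[rotated])
    show "(\<lambda>s. \<alpha> + 1 / real s) \<longlonglongrightarrow> \<alpha>"
      using tendsto_add[OF tendsto_const lim_const_over_n[of 1]] by simp
  qed auto
  thus ?thesis by (simp add: \<alpha>)
qed

end
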